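(* Up to transposition, a $(2,3.000164233)$-admissible word $\theta$ has the form $$\theta=\dots 2_4\,1_2\,2_6\,1_2\,2_4\,1_2\,2^*\,2_4\,1_2\,2_6\,1_2\,2_4\,1_2\,2_2\dots$$ In particular, it contains the string $\theta_2^0=2_4\,1_2\,2_6\,1_2\,2_4\,1_2\,2^*\,2_4\,1_2\,2_6\,1_2\,2_4\,1$.
   Context: All words are over the alphabet $\{1,2\}$. Subscripts indicate repetition of a character (e.g. $1_2 2_4$ is $112222$), and an asterisk marks the entry in position $0$; writing $\theta=\dots u\dots$ means that $\theta$ contains the string $u$ with its starred entry at position $0$. For $\theta=(a_n)_{n\in\mathbb{Z}}\in\{1,2\}^{\mathbb{Z}}$ put $\lambda_i(\theta)=[a_i;a_{i+1},a_{i+2},\dots]+[0;a_{i-1},a_{i-2},\dots]$ and $m(\theta)=\sup_{i\in\mathbb{Z}}\lambda_i(\theta)$. For $k\ge1$ let $\underline{\omega}_k=2_{2k}\,1_2\,2_{2k+1}\,1_2\,2_{2k+2}\,1_2$ and let $\theta(\underline{\omega}_k)$ be the bi-infinite periodic word obtained by repeating $\underline{\omega}_k$. A word $\theta\in\{1,2\}^{\mathbb{Z}}$ is $(k,\lambda)$-admissible if $m(\theta(\underline{\omega}_k))<m(\theta)=\lambda_0(\theta)<\lambda$. The transposition of $\theta=(a_n)_{n\in\mathbb{Z}}$ is $(a_{-n})_{n\in\mathbb{Z}}$; "up to transposition" means that $\theta$ or its transposition has the stated form. *)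

theory Defs
  imports Complex_Main
begin

fun cf_convergent :: "(nat \<Rightarrow> nat) \<Rightarrow> nat \<Rightarrow> real" where
  "cf_convergent a 0 = real (a 0)"
| "cf_convergent a (Suc n) = real (a 0) + 1 / cf_convergent (\<lambda>i. a (Suc i)) n"

text \<open>The value \<open>[a 0; a 1, a 2, \<dots>]\<close>. The limit exists whenever
  \<open>a n\<close> is positive for all \<open>n \<ge> 1\<close>; \<open>a 0\<close> may be 0.\<close>

definition cf_value :: "(nat \<Rightarrow> nat) \<Rightarrow> real" where
  "cf_value a = lim (cf_convergent a)"

definition words :: "(int \<Rightarrow> nat) set" where
  "words = {\<theta>. \<forall>n. \<theta> n \<in> {1, 2}}"

definition lambda_at :: "int \<Rightarrow> (int \<Rightarrow> nat) \<Rightarrow> real" where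
  "lambda_at i \<theta> = cf_value (\<lambda>n. \<theta> (i + int n))
                 + cf_value (\<lambda>n. if n = 0 then 0 else \<theta> (i - int n))"

text \<open>For words over \<open>{1, 2}\<close> the values \<open>lambda_at i \<theta>\<close> are bounded by 4, so the
  supremum below is a genuine one.\<close>

definition markov_value :: "(int \<Rightarrow> nat) \<Rightarrow> real" where
  "markov_value \<theta> = (SUP i. lambda_at i \<theta>)"

definition periodic_word :: "nat list \<Rightarrow> int \<Rightarrow> nat" where
  "periodic_word w n = w ! nat (n mod int (length w))"

definition omega :: "nat \<Rightarrow> nat list" where
  "omega k = replicate (2 * k) 2 @ replicate 2 1 @ replicate (2 * k + 1) 2 @ replicate 2 1
           @ replicate (2 * k + 2) 2 @ replicate 2 1"

definition admissible :: "nat \<Rightarrow> real \<Rightarrow> (int \<Rightarrow> nat) \<Rightarrow> bool" where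
  "admissible k l \<theta> \<longleftrightarrow> \<theta> \<in> words
     \<and> markov_value (periodic_word (omega k)) < markov_value \<theta>
     \<and> markov_value \<theta> = lambda_at 0 \<theta>
     \<and> lambda_at 0 \<theta> < l"

definition transposition :: "(int \<Rightarrow> nat) \<Rightarrow> int \<Rightarrow> nat" where
  "transposition \<theta> n = \<theta> (- n)"

text \<open>\<open>has_string \<theta> u c v\<close> says that \<open>\<theta> = \<dots> u c\<^sup>* v \<dots>\<close>, the starred letter \<open>c\<close> being
  the entry of \<open>\<theta>\<close> in position 0.\<close>

definition has_string :: "(int \<Rightarrow> nat) \<Rightarrow> nat list \<Rightarrow> nat \<Rightarrow> nat list \<Rightarrow> bool" where
  "has_string \<theta> u c v \<longleftrightarrow>
     (\<forall>j < length (u @ c # v). \<theta> (int j - int (length u)) = (u @ c # v) ! j)"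

end

theory Submission
  imports Defs "HOL-Library.Sublist"
begin

text \<open>Knowing finitely many letters on both sides of a position encloses \<open>\<lambda>\<^sub>i(\<theta>)\<close> in an interval
  with rational end points. In an admissible word no \<open>\<lambda>\<^sub>i\<close> reaches \<open>3.000164233\<close>, which forbids
  thirteen strings and their reversals; and \<open>\<lambda>\<^sub>0\<close> exceeds \<open>3.000164231218189\<close>, a lower bound of
  \<open>m(\<theta>(\<omega>\<^sub>2))\<close> that differs from it by less than \<open>5 \<cdot> 10\<^sup>-\<^sup>1\<^sup>6\<close>. Extending a window around position 0
  letter by letter, alternately on the two sides, and discarding it as soon as one of these conditions
  fails leaves, after at most 44 letters besides the central one, only windows that contain the
  asserted string or its reversal.\<close>

section \<open>Continued fractions with partial quotients 1 and 2\<close>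

lemma cf_convergent_bounds:
  assumes "\<And>n. a n \<in> {1, 2}"
  shows "1 \<le> cf_convergent a n \<and> cf_convergent a n \<le> 3"
  using assms
proof (induction n arbitrary: a)
  case 0
  from 0[of 0] show ?case by auto
next
  case (Suc n)
  have "1 \<le> cf_convergent (\<lambda>i. a (Suc i)) n"
    using Suc.IH[of "\<lambda>i. a (Suc i)", OF Suc.prems] by simp
  then have "0 < 1 / cf_convergent (\<lambda>i. a (Suc i)) n"
    and "1 / cf_convergent (\<lambda>i. a (Suc i)) n \<le> 1"
    by (auto simp: divide_simps)
  moreover have "1 \<le> real (a 0)" "real (a 0) \<le> 2"
    using Suc.prems[of 0] by auto
  ultimately show ?case by (simp only: cf_convergent.simps) linarith
qed

text \<open>The tail is at most 3, so its reciprocal adds at least 1/3 to a leading letter that is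
  at least 1. This excess over 1 supplies the contraction factor 3/4 below.\<close>

lemma cf_convergent_Suc_ge:
  assumes "\<And>n. a n \<in> {1, 2}"
  shows "4 / 3 \<le> cf_convergent a (Suc n)"
proof -
  have "1 \<le> cf_convergent (\<lambda>i. a (Suc i)) n" "cf_convergent (\<lambda>i. a (Suc i)) n \<le> 3"
    using cf_convergent_bounds[of "\<lambda>i. a (Suc i)", OF assms] by simp_all
  then have "1 / 3 \<le> 1 / cf_convergent (\<lambda>i. a (Suc i)) n"
    by (auto simp: divide_simps)
  moreover have "1 \<le> real (a 0)"
    using assms[of 0] by auto
  ultimately show ?thesis by simp
qed

text \<open>Both convergents share the leading letter, so their difference is
  \<open>1 / x - 1 / y\<close> for convergents of the shifted sequence, and \<open>x * y\<close> is
  at least 4/3.\<close>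

lemma cf_convergent_diff_le:
  assumes "\<And>n. a n \<in> {1, 2}"
  shows "\<bar>cf_convergent a (Suc n) - cf_convergent a n\<bar> \<le> (3 / 4) ^ n"
  using assms
proof (induction n arbitrary: a)
  case 0
  from 0[of 1] show ?case by auto
next
  case (Suc n)
  define x where "x = cf_convergent (\<lambda>i. a (Suc i)) (Suc n)"
  define y where "y = cf_convergent (\<lambda>i. a (Suc i)) n"
  have y: "1 \<le> y"
    unfolding y_def using cf_convergent_bounds[of "\<lambda>i. a (Suc i)", OF Suc.prems] by simp
  have x: "4 / 3 \<le> x"
    unfolding x_def using cf_convergent_Suc_ge[of "\<lambda>i. a (Suc i)", OF Suc.prems] .
  have "\<bar>x - y\<bar> \<le> (3 / 4) ^ n"
    unfolding x_def y_def using Suc.IH[of "\<lambda>i. a (Suc i)", OF Suc.prems] .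
  moreover have "4 / 3 \<le> x * y"
    using mult_mono[OF x y] x by simp
  ultimately have "\<bar>x - y\<bar> / (x * y) \<le> (3 / 4) ^ n / (4 / 3)"
    using x y by (intro frac_le) auto
  moreover have "\<bar>1 / x - 1 / y\<bar> = \<bar>x - y\<bar> / (x * y)"
  proof -
    have "1 / x - 1 / y = (y - x) / (x * y)"
      using x y by (simp add: field_simps)
    then show ?thesis
      using x y by (simp add: abs_divide abs_mult abs_minus_commute)
  qed
  moreover have "cf_convergent a (Suc (Suc n)) - cf_convergent a (Suc n) = 1 / x - 1 / y"
    by (simp add: x_def y_def)
  ultimately show ?case by simp
qed

lemma cf_convergent_tendsto:
  assumes "\<And>n. a n \<in> {1, 2}"
  shows "cf_convergent a \<longlonglongrightarrow> cf_value a"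
proof -
  let ?d = "\<lambda>n. cf_convergent a (Suc n) - cf_convergent a n"
  have "summable ?d"
    by (rule summable_comparison_test'[where g = "\<lambda>n. (3 / 4) ^ n" and N = 0])
      (use cf_convergent_diff_le[of a, OF assms] in \<open>simp_all add: summable_geometric\<close>)
  from summable_LIMSEQ[OF this]
  have "(\<lambda>n. cf_convergent a n - cf_convergent a 0) \<longlonglongrightarrow> suminf ?d"
    by (simp only: sum_lessThan_telescope)
  from tendsto_add[OF this tendsto_const[of "cf_convergent a 0"]]
  have "convergent (cf_convergent a)"
    by (auto simp: convergent_def)
  then show ?thesis
    by (simp add: cf_value_def convergent_LIMSEQ_iff)
qed

lemma cf_value_ge_1:
  assumes "\<And>n. a n \<in> {1, 2}"
  shows "1 \<le> cf_value a"
  using cf_convergent_tendsto[of a, OF assms] cf_convergent_bounds[of a, OF assms]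
  by (intro LIMSEQ_le_const) auto

lemma cf_value_le_3:
  assumes "\<And>n. a n \<in> {1, 2}"
  shows "cf_value a \<le> 3"
  using cf_convergent_tendsto[of a, OF assms] cf_convergent_bounds[of a, OF assms]
  by (intro LIMSEQ_le_const2) auto

text \<open>\<open>a 0\<close> is left unconstrained because the left half of
  \<open>lambda_at\<close> is a continued fraction with leading entry 0.\<close>

lemma cf_value_unfold:
  assumes "\<And>n. a (Suc n) \<in> {1, 2}"
  shows "cf_value a = real (a 0) + 1 / cf_value (\<lambda>n. a (Suc n))"
proof -
  have "(\<lambda>n. real (a 0) + 1 / cf_convergent (\<lambda>i. a (Suc i)) n)
          \<longlonglongrightarrow> real (a 0) + 1 / cf_value (\<lambda>n. a (Suc n))"
    using cf_value_ge_1[of "\<lambda>n. a (Suc n)", OF assms]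
      cf_convergent_tendsto[of "\<lambda>n. a (Suc n)", OF assms]
    by (intro tendsto_intros) auto
  then have "(\<lambda>n. cf_convergent a (Suc n)) \<longlonglongrightarrow> real (a 0) + 1 / cf_value (\<lambda>n. a (Suc n))"
    by simp
  then have "cf_convergent a \<longlonglongrightarrow> real (a 0) + 1 / cf_value (\<lambda>n. a (Suc n))"
    by (rule LIMSEQ_imp_Suc)
  then show ?thesis
    unfolding cf_value_def by (rule limI)
qed

text \<open>The crude upper bound 3 gives 1 + 1/3 from below, and this in turn gives 2 + 3/4 from
  above. These end points enclose an unknown tail in \<open>enclosure []\<close>.\<close>

lemma cf_value_tail_bounds:
  assumes a: "\<And>n. a n \<in> {1, 2}"
  shows "4 / 3 \<le> cf_value a" "cf_value a \<le> 11 / 4"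
proof -
  have *: "4 / 3 \<le> cf_value b" if b: "\<And>n. b n \<in> {1, 2}" for b
  proof -
    have "1 \<le> cf_value (\<lambda>n. b (Suc n))" "cf_value (\<lambda>n. b (Suc n)) \<le> 3"
      by (intro cf_value_ge_1 cf_value_le_3 b)+
    then have "1 / 3 \<le> 1 / cf_value (\<lambda>n. b (Suc n))"
      by (simp add: divide_simps)
    with b[of 0] cf_value_unfold[of b, OF b] show ?thesis by auto
  qed
  show "4 / 3 \<le> cf_value a"
    by (rule *) (rule a)
  have "4 / 3 \<le> cf_value (\<lambda>n. a (Suc n))"
    by (rule *) (rule a)
  then have "1 / cf_value (\<lambda>n. a (Suc n)) \<le> 3 / 4"
    by (simp add: divide_simps)
  with a[of 0] cf_value_unfold[of a, OF a] show "cf_value a \<le> 11 / 4" by auto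
qed

section \<open>Rational enclosures from finitely many letters\<close>

definition starts_with :: "(nat \<Rightarrow> nat) \<Rightarrow> nat list \<Rightarrow> bool" where
  "starts_with a w \<longleftrightarrow> (\<forall>j < length w. a j = w ! j)"

lemma starts_with_Nil [simp]: "starts_with a []"
  by (simp add: starts_with_def)

lemma starts_with_Cons:
  "starts_with a (x # w) \<longleftrightarrow> a 0 = x \<and> starts_with (\<lambda>n. a (Suc n)) w"
  by (simp add: starts_with_def All_less_Suc2)

lemma starts_with_append:
  "starts_with a (v @ w) \<longleftrightarrow> starts_with a v \<and> starts_with (\<lambda>n. a (length v + n)) w"
  by (induction v arbitrary: a) (auto simp: starts_with_Cons)

lemma starts_with_prefix: "starts_with a w \<Longrightarrow> prefix v w \<Longrightarrow> starts_with a v"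
  by (auto simp: prefix_def starts_with_append)

text \<open>The quadruple \<open>(p, q, r, s)\<close> stands for the interval \<open>[p / q, r / s]\<close>.\<close>

fun enclosure :: "nat list \<Rightarrow> int \<times> int \<times> int \<times> int" where
  "enclosure [] = (4, 3, 11, 4)"
| "enclosure (a # w) =
     (case enclosure w of (p, q, r, s) \<Rightarrow> (int a * r + s, r, int a * p + q, p))"

text \<open>The map from \<open>y\<close> to \<open>x + 1 / y\<close> is decreasing for positive
  \<open>y\<close>, so each letter exchanges the roles of the two end points. Positivity is carried
  along for clearing denominators.\<close>

lemma enclosure_sound:
  assumes "\<And>n. a n \<in> {1, 2}" "starts_with a w" "enclosure w = (p, q, r, s)"
  shows "0 < p \<and> 0 < q \<and> 0 < r \<and> 0 < s \<and> of_int p / of_int q \<le> cf_value a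
    \<and> cf_value a \<le> of_int r / of_int s"
  using assms
proof (induction w arbitrary: a p q r s)
  case Nil
  then show ?case using cf_value_tail_bounds[of a] by auto
next
  case (Cons x w)
  define y where "y = cf_value (\<lambda>n. a (Suc n))"
  obtain p' q' r' s' where e: "enclosure w = (p', q', r', s')"
    by (metis prod_cases4)
  have IH: "0 < p'" "0 < q'" "0 < r'" "0 < s'"
    "of_int p' / of_int q' \<le> y" "y \<le> of_int r' / of_int s'"
    unfolding y_def using Cons.IH[OF _ _ e, of "\<lambda>n. a (Suc n)"] Cons.prems
    by (simp_all add: starts_with_Cons)
  have x: "cf_value a = real x + 1 / y"
    using cf_value_unfold[of a] Cons.prems unfolding y_def by (simp add: starts_with_Cons)
  have "1 \<le> y"
    unfolding y_def by (intro cf_value_ge_1 Cons.prems)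
  then have "of_int s' / of_int r' \<le> 1 / y" "1 / y \<le> of_int q' / of_int p'"
    using IH by (simp_all add: field_simps)
  moreover have "p = int x * r' + s'" "q = r'" "r = int x * p' + q'" "s = p'"
    using Cons.prems(3) by (auto simp: e)
  ultimately show ?case
    using IH x by (auto simp: add_divide_distrib intro: add_nonneg_pos)
qed

section \<open>Windows around a position\<close>

definition right_of :: "int \<Rightarrow> (int \<Rightarrow> nat) \<Rightarrow> nat \<Rightarrow> nat" where
  "right_of i \<theta> n = \<theta> (i + 1 + int n)"

definition left_of :: "int \<Rightarrow> (int \<Rightarrow> nat) \<Rightarrow> nat \<Rightarrow> nat" where
  "left_of i \<theta> n = \<theta> (i - 1 - int n)"

lemma letters_beside:
  assumes "\<theta> \<in> words"
  shows "right_of i \<theta> n \<in> {1, 2}" "left_of i \<theta> n \<in> {1, 2}"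
  using assms unfolding words_def right_of_def left_of_def by blast+

lemma lambda_at_eq:
  assumes "\<theta> \<in> words"
  shows "lambda_at i \<theta> =
    real (\<theta> i) + 1 / cf_value (right_of i \<theta>) + 1 / cf_value (left_of i \<theta>)"
proof -
  have "right_of i \<theta> = (\<lambda>n. \<theta> (i + int (Suc n)))" "left_of i \<theta> = (\<lambda>n. \<theta> (i - int (Suc n)))"
    by (auto simp: right_of_def left_of_def fun_eq_iff algebra_simps)
  moreover have "\<theta> j \<in> {1, 2}" for j
    using assms unfolding words_def by blast
  ultimately show ?thesis
    unfolding lambda_at_def
    using cf_value_unfold[of "\<lambda>n. \<theta> (i + int n)"]
      cf_value_unfold[of "\<lambda>n. if n = 0 then 0 else \<theta> (i - int n)"]
    by simp
qed

lemma lambda_at_le_4: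
  assumes "\<theta> \<in> words"
  shows "lambda_at i \<theta> \<le> 4"
proof -
  have "1 / cf_value a \<le> 1" if "\<And>n. a n \<in> {1, 2}" for a
    using cf_value_ge_1[of a, OF that] by simp
  from this[of "right_of i \<theta>"] this[of "left_of i \<theta>"]
  have "1 / cf_value (right_of i \<theta>) \<le> 1" "1 / cf_value (left_of i \<theta>) \<le> 1"
    using letters_beside[OF assms] by blast+
  moreover have "real (\<theta> i) \<le> 2"
    using assms by (auto simp: words_def dest!: spec[of _ i])
  ultimately show ?thesis
    unfolding lambda_at_eq[OF assms] by linarith
qed

lemma lambda_at_le_markov_value:
  assumes "\<theta> \<in> words"
  shows "lambda_at i \<theta> \<le> markov_value \<theta>"
  unfolding markov_value_def
  by (intro cSUP_upper bdd_aboveI[of _ 4]) (auto simp: lambda_at_le_4[OF assms])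

lemma transposition_transposition [simp]: "transposition (transposition \<theta>) = \<theta>"
  by (simp add: transposition_def fun_eq_iff)

lemma transposition_words: "\<theta> \<in> words \<Longrightarrow> transposition \<theta> \<in> words"
  by (simp add: words_def transposition_def)

lemma right_of_transposition: "right_of i (transposition \<theta>) = left_of (- i) \<theta>"
  by (auto simp: right_of_def left_of_def transposition_def intro!: ext arg_cong[where f = \<theta>])

lemma left_of_transposition: "left_of i (transposition \<theta>) = right_of (- i) \<theta>"
  by (auto simp: right_of_def left_of_def transposition_def intro!: ext arg_cong[where f = \<theta>])

lemma lambda_at_transposition:
  assumes "\<theta> \<in> words"
  shows "lambda_at i (transposition \<theta>) = lambda_at (- i) \<theta>"
  unfolding lambda_at_eq[OF assms] lambda_at_eq[OF transposition_words[OF assms]]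
    right_of_transposition left_of_transposition
  by (simp add: transposition_def)

text \<open>A window \<open>rev u @ c # v\<close> lists the letters to the left of the centre \<open>c\<close> in \<open>u\<close>,
  nearest first.\<close>

definition window :: "(int \<Rightarrow> nat) \<Rightarrow> int \<Rightarrow> nat list \<Rightarrow> nat \<Rightarrow> nat list \<Rightarrow> bool" where
  "window \<theta> i u c v \<longleftrightarrow>
     starts_with (left_of i \<theta>) u \<and> \<theta> i = c \<and> starts_with (right_of i \<theta>) v"

lemma window_transposition: "window (transposition \<theta>) i u c v \<longleftrightarrow> window \<theta> (- i) v c u"
  by (auto simp: window_def right_of_transposition left_of_transposition transposition_def)

lemma window_prefix:
  "window \<theta> i u c v \<Longrightarrow> prefix u' u \<Longrightarrow> prefix v' v \<Longrightarrow> window \<theta> i u' c v'"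
  by (auto simp: window_def intro: starts_with_prefix)

lemma window_snoc: "window \<theta> i u c v \<Longrightarrow> window \<theta> i u c (v @ [\<theta> (i + 1 + int (length v))])"
  by (simp add: window_def starts_with_append starts_with_Cons right_of_def)

lemma window_shift:
  "window \<theta> i (x # u) c v \<longleftrightarrow> window \<theta> (i - 1) u x (c # v)"
proof -
  have "(\<lambda>n. left_of i \<theta> (Suc n)) = left_of (i - 1) \<theta>"
    "(\<lambda>n. right_of (i - 1) \<theta> (Suc n)) = right_of i \<theta>"
    by (auto simp: left_of_def right_of_def fun_eq_iff algebra_simps)
  then show ?thesis
    by (auto simp: window_def starts_with_Cons left_of_def right_of_def)
qed

text \<open>Moving the centre leftwards one letter at a time turns a window into a contiguous string
  read from its leftmost letter, the form in which \<open>has_string\<close> and the forbidden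
  strings are given.\<close>

lemma window_iff_starts_with:
  "window \<theta> i u c v \<longleftrightarrow> starts_with (\<lambda>n. \<theta> (i - int (length u) + int n)) (rev u @ c # v)"
proof (induction u arbitrary: i c v)
  case Nil
  show ?case
    by (simp add: window_def starts_with_Cons right_of_def[abs_def] add_ac)
next
  case (Cons x u)
  show ?case by (simp add: window_shift Cons algebra_simps)
qed

lemma has_string_iff_window: "has_string \<theta> u c v \<longleftrightarrow> window \<theta> 0 (rev u) c v"
  by (simp add: window_iff_starts_with has_string_def starts_with_def algebra_simps)

section \<open>Bounds on \<open>lambda_at\<close> tested in integer arithmetic\<close>

definition lambda_at_most :: "int \<times> int \<Rightarrow> nat list \<Rightarrow> nat \<Rightarrow> nat list \<Rightarrow> bool" where
  "lambda_at_most b u c v = (case (b, enclosure u, enclosure v) of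
     ((m, d), (p, q, _, _), (p', q', _, _)) \<Rightarrow>
       d * (int c * (p * p') + q * p' + q' * p) \<le> m * (p * p'))"

definition lambda_at_least :: "int \<times> int \<Rightarrow> nat list \<Rightarrow> nat \<Rightarrow> nat list \<Rightarrow> bool" where
  "lambda_at_least b u c v = (case (b, enclosure u, enclosure v) of
     ((m, d), (_, _, r, s), (_, _, r', s')) \<Rightarrow>
       m * (r * r') \<le> d * (int c * (r * r') + s * r' + s' * r))"

lemma frac_sum_le_iff:
  fixes p q p' q' m d :: real
  assumes "0 < p" "0 < p'" "0 < d"
  shows "c + q' / p' + q / p \<le> m / d \<longleftrightarrow> d * (c * (p * p') + q * p' + q' * p) \<le> m * (p * p')"
    and "m / d \<le> c + q' / p' + q / p \<longleftrightarrow> m * (p * p') \<le> d * (c * (p * p') + q * p' + q' * p)"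
proof -
  have eq: "c + q' / p' + q / p = (c * (p * p') + q * p' + q' * p) / (p * p')"
    using assms by (simp add: field_simps)
  show "c + q' / p' + q / p \<le> m / d \<longleftrightarrow> d * (c * (p * p') + q * p' + q' * p) \<le> m * (p * p')"
    and "m / d \<le> c + q' / p' + q / p \<longleftrightarrow> m * (p * p') \<le> d * (c * (p * p') + q * p' + q' * p)"
    unfolding eq using assms by (simp_all add: divide_le_eq le_divide_eq mult.commute)
qed

text \<open>Lower end points of the two tails bound their reciprocals from above; this is why
  \<open>lambda_at_most\<close> uses the lower and \<open>lambda_at_least\<close> the upper end
  points.\<close>

lemma lambda_at_most_sound:
  assumes \<theta>: "\<theta> \<in> words" and w: "window \<theta> i u c v" and "lambda_at_most (m, d) u c v" "0 < d"
  shows "lambda_at i \<theta> \<le> of_int m / of_int d"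
proof -
  obtain p q r s where e: "enclosure u = (p, q, r, s)" by (metis prod_cases4)
  obtain p' q' r' s' where e': "enclosure v = (p', q', r', s')" by (metis prod_cases4)
  let ?x = "cf_value (left_of i \<theta>)" and ?y = "cf_value (right_of i \<theta>)"
  have x: "0 < p" "0 < q" "of_int p / of_int q \<le> ?x"
    and y: "0 < p'" "0 < q'" "of_int p' / of_int q' \<le> ?y"
    using enclosure_sound[of "left_of i \<theta>", OF letters_beside(2)[OF \<theta>] _ e]
      enclosure_sound[of "right_of i \<theta>", OF letters_beside(1)[OF \<theta>] _ e'] w
    by (simp_all add: window_def)
  have pos: "1 \<le> ?x" "1 \<le> ?y"
    by (intro cf_value_ge_1 letters_beside[OF \<theta>])+
  have "d * (int c * (p * p') + q * p' + q' * p) \<le> m * (p * p')"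
    using assms(3) by (simp add: lambda_at_most_def e e')
  then have le: "real_of_int (d * (int c * (p * p') + q * p' + q' * p)) \<le> real_of_int (m * (p * p'))"
    by (simp only: of_int_le_iff)
  have "1 / ?x \<le> of_int q / of_int p" "1 / ?y \<le> of_int q' / of_int p'"
    using x y pos by (simp_all add: field_simps)
  then have "lambda_at i \<theta> \<le> real c + of_int q' / of_int p' + of_int q / of_int p"
    using w by (simp add: lambda_at_eq[OF \<theta>] window_def)
  also have "\<dots> \<le> of_int m / of_int d"
    using le assms(4) x y by (subst frac_sum_le_iff) simp_all
  finally show ?thesis .
qed

lemma lambda_at_least_sound:
  assumes \<theta>: "\<theta> \<in> words" and w: "window \<theta> i u c v" and "lambda_at_least (m, d) u c v" "0 < d"
  shows "of_int m / of_int d \<le> lambda_at i \<theta>"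
proof -
  obtain p q r s where e: "enclosure u = (p, q, r, s)" by (metis prod_cases4)
  obtain p' q' r' s' where e': "enclosure v = (p', q', r', s')" by (metis prod_cases4)
  let ?x = "cf_value (left_of i \<theta>)" and ?y = "cf_value (right_of i \<theta>)"
  have x: "0 < r" "0 < s" "?x \<le> of_int r / of_int s"
    and y: "0 < r'" "0 < s'" "?y \<le> of_int r' / of_int s'"
    using enclosure_sound[of "left_of i \<theta>", OF letters_beside(2)[OF \<theta>] _ e]
      enclosure_sound[of "right_of i \<theta>", OF letters_beside(1)[OF \<theta>] _ e'] w
    by (simp_all add: window_def)
  have pos: "1 \<le> ?x" "1 \<le> ?y"
    by (intro cf_value_ge_1 letters_beside[OF \<theta>])+
  have "m * (r * r') \<le> d * (int c * (r * r') + s * r' + s' * r)"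
    using assms(3) by (simp add: lambda_at_least_def e e')
  then have le: "real_of_int (m * (r * r')) \<le> real_of_int (d * (int c * (r * r') + s * r' + s' * r))"
    by (simp only: of_int_le_iff)
  have "of_int m / of_int d \<le> real c + of_int s' / of_int r' + of_int s / of_int r"
    using le assms(4) x y by (subst frac_sum_le_iff) simp_all
  also have "of_int s / of_int r \<le> 1 / ?x" "of_int s' / of_int r' \<le> 1 / ?y"
    using x y pos by (simp_all add: field_simps)
  then have "real c + of_int s' / of_int r' + of_int s / of_int r \<le> lambda_at i \<theta>"
    using w by (simp add: lambda_at_eq[OF \<theta>] window_def)
  finally show ?thesis .
qed

section \<open>The search\<close>

text \<open>A consequence of admissibility with rational thresholds only, chosen to be invariant
  under transposition.\<close>

definition confined :: "(int \<Rightarrow> nat) \<Rightarrow> bool" where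
  "confined \<theta> \<longleftrightarrow> \<theta> \<in> words \<and> (\<forall>i. lambda_at i \<theta> < 3.000164233)
     \<and> 3.000164231218189 < lambda_at 0 \<theta>"

lemma confined_transposition: "confined \<theta> \<Longrightarrow> confined (transposition \<theta>)"
  by (simp add: confined_def transposition_words lambda_at_transposition)

text \<open>The pairs \<open>(u, v)\<close> stand for the strings \<open>rev u @ 2 # v\<close>, which force \<open>\<lambda> \<ge> 3.000164233\<close> at
  the letter 2 displayed. The list results from a computer search and was thinned out greedily.\<close>

definition forbidden_centres :: "(nat list \<times> nat list) list" where
  "forbidden_centres =
    [([1], [1]),
     ([], [1,2]),
     ([1,1,1], [2,2]),
     ([2,1,1], [1,1,1,2]),
     ([2,2,1], [1,1,2,2]),
     ([1,1,1,1,1], [2,1,1,2]),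
     ([1,1,2,2,1], [2,2,2,2]),
     ([2,1,1,1,1], [1,1,1,1,1,2]),
     ([2,1,1,1,1,2], [1,1,1,1,1,1,1]),
     ([1,1,1,1,1,1,1,2], [2,1,1,1,1,1,1]),
     ([2,2,2,2,1,1,2,2,2,2], [1,1,2,2,2,2,1,1,2,2,1]),
     ([1,1,2,2,2,2,1,1,2,2,2,2], [2,2,2,2,1,1,2,2,2,2,1]),
     ([1,1,2,2,2,2,1,1,2,2,2,2,1], [2,2,2,2,1,1,2,2,2,2,2,2])]"

definition forbidden_strings :: "nat list list" where
  "forbidden_strings =
     concat (map (\<lambda>(u, v). [rev u @ 2 # v, rev v @ 2 # u]) forbidden_centres)"

lemma confined_no_centre:
  assumes "confined \<theta>" "(u, v) \<in> set forbidden_centres"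
  shows "\<not> window \<theta> i u 2 v"
proof
  assume w: "window \<theta> i u 2 v"
  \<comment> \<open>A single evaluation checks all thirteen strings.\<close>
  have "list_all (\<lambda>(u, v). lambda_at_least (3000164233, 1000000000) u 2 v) forbidden_centres"
    by code_simp
  with assms(2) have "lambda_at_least (3000164233, 1000000000) u 2 v"
    by (auto simp: list_all_iff)
  from lambda_at_least_sound[OF _ w this] assms(1) have "3.000164233 \<le> lambda_at i \<theta>"
    by (simp add: confined_def)
  moreover have "lambda_at i \<theta> < 3.000164233"
    using assms(1) by (simp add: confined_def)
  ultimately show False by linarith
qed

text \<open>A listed string is excluded by its centre; a reversed one becomes a listed one in the
  transposition, which is confined as well.\<close>

lemma confined_no_string:
  assumes \<theta>: "confined \<theta>" and "s \<in> set forbidden_strings" and w: "window \<theta> i u c v"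
  shows "\<not> prefix s (rev u @ c # v)"
proof
  assume "prefix s (rev u @ c # v)"
  with w have s: "starts_with (\<lambda>n. \<theta> (i - int (length u) + int n)) s"
    unfolding window_iff_starts_with by (rule starts_with_prefix)
  from assms(2) obtain y z where yz: "(y, z) \<in> set forbidden_centres"
    and "s = rev y @ 2 # z \<or> s = rev z @ 2 # y"
    unfolding forbidden_strings_def by auto
  then show False
  proof (elim disjE)
    assume "s = rev y @ 2 # z"
    \<comment> \<open>\<open>s\<close> begins at the leftmost letter of the window, so its displayed
      2 lies \<open>length y\<close> places further right.\<close>
    with s have "window \<theta> (i - int (length u) + int (length y)) y 2 z"
      by (simp add: window_iff_starts_with)
    with confined_no_centre[OF \<theta> yz] show False by blast
  next
    assume "s = rev z @ 2 # y"
    with s have "window \<theta> (i - int (length u) + int (length z)) z 2 y"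
      by (simp add: window_iff_starts_with)
    then have "window (transposition \<theta>) (- (i - int (length u) + int (length z))) y 2 z"
      by (simp only: window_transposition minus_minus)
    with confined_no_centre[OF confined_transposition[OF \<theta>] yz] show False by blast
  qed
qed

definition goal_left :: "nat list" where
  "goal_left = [1,1,2,2,2,2,1,1,2,2,2,2,2,2,1,1,2,2,2,2]"

definition goal_right :: "nat list" where
  "goal_right = [2,2,2,2,1,1,2,2,2,2,2,2,1,1,2,2,2,2,1,1,2,2]"

definition goal :: "nat list \<Rightarrow> nat list \<Rightarrow> bool" where
  "goal u v \<longleftrightarrow> prefix goal_left u \<and> prefix goal_right v"

text \<open>The window is extended on the right and then reversed, so that both sides grow in turn. This
  is sound because the hypotheses are invariant under transposition. A new letter thus always comes
  first, and only prefixes have to be compared with the forbidden strings. The conditionals replace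
  connectives because the simplifier would evaluate both arguments of a conjunction.\<close>

fun covered :: "nat list list \<Rightarrow> nat \<Rightarrow> nat list \<Rightarrow> nat \<Rightarrow> nat list \<Rightarrow> bool" where
  "covered F 0 u c v = False"
| "covered F (Suc n) u c v =
    (if list_ex (\<lambda>s. prefix s (rev u @ c # v)) F then True
     else if lambda_at_most (3000164231218189, 1000000000000000) u c v then True
     else if c = 2 \<and> (goal u v \<or> goal v u) then True
     else if covered F n (v @ [1]) c u then covered F n (v @ [2]) c u else False)"

text \<open>The induction generalises \<theta> because the recursive calls exchange the two sides
  and hence concern its transposition; the pair of \<theta> and its transposition is stable under
  this exchange.\<close>

lemma covered_sound:
  assumes "covered forbidden_strings n u c v" "confined \<theta>" "window \<theta> 0 u c v"
  shows "\<exists>\<eta> \<in> {\<theta>, transposition \<theta>}. window \<eta> 0 goal_left 2 goal_right"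
  using assms
proof (induction n arbitrary: \<theta> u c v)
  case 0
  then show ?case by simp
next
  case (Suc n)
  note \<theta> = \<open>confined \<theta>\<close> and w = \<open>window \<theta> 0 u c v\<close>
  have "\<not> list_ex (\<lambda>s. prefix s (rev u @ c # v)) forbidden_strings"
    using confined_no_string[OF \<theta> _ w] by (auto simp: list_ex_iff)
  moreover have "\<not> lambda_at_most (3000164231218189, 1000000000000000) u c v"
  proof
    assume "lambda_at_most (3000164231218189, 1000000000000000) u c v"
    from lambda_at_most_sound[OF _ w this] \<theta>
    have "lambda_at 0 \<theta> \<le> 3.000164231218189"
      by (simp add: confined_def)
    with \<theta> show False
      by (simp add: confined_def)
  qed
  ultimately consider "c = 2" "goal u v" | "c = 2" "goal v u"
    | "covered forbidden_strings n (v @ [1]) c u" "covered forbidden_strings n (v @ [2]) c u"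
    using Suc.prems(1) by (auto split: if_splits)
  then show ?case
  proof cases
    case 1
    with w show ?thesis by (auto simp: goal_def intro: window_prefix)
  next
    case 2
    \<comment> \<open>The window contains the reversed goal, so the transposition is the
      witness.\<close>
    from w have "window (transposition \<theta>) 0 v c u"
      by (simp add: window_transposition)
    with 2 show ?thesis by (auto simp: goal_def intro: window_prefix)
  next
    case 3
    define x where "x = \<theta> (1 + int (length v))"
    have "window \<theta> 0 u c (v @ [x])"
      using window_snoc[OF w] by (simp add: x_def)
    then have "window (transposition \<theta>) 0 (v @ [x]) c u"
      by (simp add: window_transposition)
    moreover have "x = 1 \<or> x = 2"
      using \<theta> by (auto simp: confined_def words_def x_def)
    then have "covered forbidden_strings n (v @ [x]) c u"
      using 3 by auto
    ultimately have "\<exists>\<eta> \<in> {transposition \<theta>, transposition (transposition \<theta>)}.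
        window \<eta> 0 goal_left 2 goal_right"
      using Suc.IH confined_transposition[OF \<theta>] by blast
    then show ?thesis by auto
  qed
qed

text \<open>The number 46 is fuel for the recursion: a window with \<open>n\<close> letters besides
  the centre is examined with fuel \<open>46 - n\<close>.\<close>

lemma covered_start: "covered forbidden_strings 46 [] 1 []" "covered forbidden_strings 46 [] 2 []"
  by code_simp+

section \<open>A lower bound for the Markov value of the periodic word\<close>

lemma periodic_word_words:
  assumes "set w \<subseteq> {1, 2}" "w \<noteq> []"
  shows "periodic_word w \<in> words"
proof -
  have "nat (n mod int (length w)) < length w" for n
    using assms(2) by (simp add: nat_less_iff)
  then show ?thesis
    using assms(1) nth_mem unfolding words_def periodic_word_def by blast
qed

lemma starts_with_map_upt: "starts_with a (map a [0..<n])"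
  by (simp add: starts_with_def)

text \<open>Position 6 is the first letter of the block \<open>2\<^sub>5\<close> of \<open>\<omega>\<^sub>2\<close>, where the maximum is attained.\<close>

lemma markov_value_omega_2_ge: "3.000164231218189 \<le> markov_value (periodic_word (omega 2))"
proof -
  let ?\<omega> = "periodic_word (omega 2)"
  have words: "?\<omega> \<in> words"
    by (intro periodic_word_words) (auto simp: omega_def)
  \<comment> \<open>With 24 letters on each side the enclosure is tight enough for all fifteen
    decimals.\<close>
  have "window ?\<omega> 6 (map (left_of 6 ?\<omega>) [0..<24]) (?\<omega> 6) (map (right_of 6 ?\<omega>) [0..<24])"
    by (simp add: window_def starts_with_map_upt)
  moreover have "lambda_at_least (3000164231218189, 1000000000000000)
      (map (left_of 6 ?\<omega>) [0..<24]) (?\<omega> 6) (map (right_of 6 ?\<omega>) [0..<24])"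
    by code_simp
  ultimately have "3.000164231218189 \<le> lambda_at 6 ?\<omega>"
    by (auto dest!: lambda_at_least_sound[OF words])
  also have "\<dots> \<le> markov_value ?\<omega>"
    by (rule lambda_at_le_markov_value[OF words])
  finally show ?thesis .
qed

theorem lemma5p12:
  fixes \<theta> :: "int \<Rightarrow> nat"
  assumes "admissible 2 3.000164233 \<theta>"
  shows "\<exists>\<eta> \<in> {\<theta>, transposition \<theta>}.
     has_string \<eta>
       (replicate 4 2 @ replicate 2 1 @ replicate 6 2 @ replicate 2 1 @ replicate 4 2
          @ replicate 2 1)
       2
       (replicate 4 2 @ replicate 2 1 @ replicate 6 2 @ replicate 2 1 @ replicate 4 2
          @ replicate 2 1 @ replicate 2 2)
   \<and> has_string \<eta>
       (replicate 4 2 @ replicate 2 1 @ replicate 6 2 @ replicate 2 1 @ replicate 4 2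
          @ replicate 2 1)
       2
       (replicate 4 2 @ replicate 2 1 @ replicate 6 2 @ replicate 2 1 @ replicate 4 2
          @ [1])"
proof -
  have "\<theta> \<in> words"
    using assms by (simp add: admissible_def)
  have "lambda_at i \<theta> < 3.000164233" for i
    using assms lambda_at_le_markov_value[OF \<open>\<theta> \<in> words\<close>, of i]
    unfolding admissible_def by linarith
  moreover have "3.000164231218189 < lambda_at 0 \<theta>"
    using assms markov_value_omega_2_ge unfolding admissible_def by linarith
  ultimately have "confined \<theta>"
    using \<open>\<theta> \<in> words\<close> by (simp add: confined_def)
  moreover have "window \<theta> 0 [] (\<theta> 0) []"
    by (simp add: window_def)
  moreover have "\<theta> 0 = 1 \<or> \<theta> 0 = 2"
    using \<open>\<theta> \<in> words\<close> by (auto simp: words_def)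
  then have "covered forbidden_strings 46 [] (\<theta> 0) []"
    using covered_start by auto
  ultimately obtain \<eta> where \<eta>: "\<eta> \<in> {\<theta>, transposition \<theta>}" "window \<eta> 0 goal_left 2 goal_right"
    using covered_sound by blast
  have goal: "replicate 4 2 @ replicate 2 1 @ replicate 6 2 @ replicate 2 1 @ replicate 4 2
      @ replicate 2 1 = rev goal_left"
    "replicate 4 2 @ replicate 2 1 @ replicate 6 2 @ replicate 2 1 @ replicate 4 2
      @ replicate 2 1 @ replicate 2 2 = goal_right"
    by (simp_all add: goal_left_def goal_right_def numeral_eq_Suc)
  \<comment> \<open>Both asserted strings share the left part and the centre, and the right part of
    the second is a prefix of that of the first, so one window yields both.\<close>
  have "has_string \<eta> (rev goal_left) 2 v" if "prefix v goal_right" for v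
    unfolding has_string_iff_window rev_rev_ident
    using \<eta>(2) that by (rule window_prefix[OF _ prefix_order.refl])
  moreover have "prefix (replicate 4 2 @ replicate 2 1 @ replicate 6 2 @ replicate 2 1 @ replicate 4 2
      @ [1]) goal_right"
    by (simp add: goal_right_def numeral_eq_Suc)
  ultimately show ?thesis
    unfolding goal using \<eta>(1) by blast
qed

end
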